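(* Let $G$ be a group, let $R$ and $T$ be $G$-graded rings, let $f:R\rightarrow T$ be a graded ring epimorphism, and let $I$ be a graded almost prime right ideal of $R$ such that $\mathrm{Ker}(f)\subseteq I$. Then $f(I)$ is a graded almost prime right ideal of $T$.
   Context: Rings are associative, not assumed commutative, and not assumed to have a unity. A ring $R$ is $G$-graded if $R=\bigoplus_{g\in G}R_g$ with $R_g$ additive subgroups and $R_gR_h\subseteq R_{gh}$ for all $g,h\in G$; $x_g$ denotes the component of $x\in R$ in $R_g$. A right ideal $P$ is graded if $P=\bigoplus_{g\in G}(P\cap R_g)$, i.e. $x\in P$ implies $x_g\in P$ for all $g\in G$. The product $XY$ of right ideals is the set of finite sums of products $xy$ with $x\in X$, $y\in Y$, and $P^2=PP$. A ring homomorphism $f:R\to T$ of $G$-graded rings is graded if $f(R_g)\subseteq T_g$ for all $g\in G$; "epimorphism" means surjective homomorphism. A proper graded right ideal $P$ of a graded ring $R$ is graded almost prime if, for all graded right ideals $X,Y$ of $R$, $XY\subseteq P$ and $XY\nsubseteq P^2$ imply $X\subseteq P$ or $Y\subseteq P$. *)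

theory Defs
  imports Main
begin

text \<open>
  Rings are types of class \<^class>\<open>ring\<close>, which requires neither commutativity of multiplication nor
  a unity.  The grading group is a type of class \<^class>\<open>group_add\<close>: an arbitrary, not necessarily
  abelian, group written additively, so that the group product \<open>gh\<close> appears as \<open>g + h\<close>.
\<close>

definition add_subgroup :: "'a::ring set \<Rightarrow> bool" where
  "add_subgroup H \<longleftrightarrow>
     0 \<in> H \<and> (\<forall>x\<in>H. \<forall>y\<in>H. x + y \<in> H) \<and> (\<forall>x\<in>H. - x \<in> H)"

text \<open>
  \<open>decomposes_as A x c\<close>: \<open>x\<close> is the sum of the finitely supported family \<open>c\<close> with \<open>c g \<in> A g\<close>.
\<close>

definition decomposes_as :: "('g \<Rightarrow> 'a::ring set) \<Rightarrow> 'a \<Rightarrow> ('g \<Rightarrow> 'a) \<Rightarrow> bool" where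
  "decomposes_as A x c \<longleftrightarrow>
     (\<forall>g. c g \<in> A g) \<and> finite {g. c g \<noteq> 0} \<and> x = (\<Sum>g\<in>{g. c g \<noteq> 0}. c g)"

text \<open>
  The existence and uniqueness clause says that the whole ring is the internal direct sum
  of the subgroups \<open>A g\<close>.
\<close>

definition grading :: "('g::group_add \<Rightarrow> 'a::ring set) \<Rightarrow> bool" where
  "grading A \<longleftrightarrow>
     (\<forall>g. add_subgroup (A g)) \<and>
     (\<forall>x. \<exists>!c. decomposes_as A x c) \<and>
     (\<forall>g h. \<forall>x\<in>A g. \<forall>y\<in>A h. x * y \<in> A (g + h))"

text \<open>Meaningful only when the decomposition is unique, in particular for a grading.\<close>

definition component :: "('g \<Rightarrow> 'a::ring set) \<Rightarrow> 'a \<Rightarrow> 'g \<Rightarrow> 'a" where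
  "component A x = (THE c. decomposes_as A x c)"

definition right_ideal :: "'a::ring set \<Rightarrow> bool" where
  "right_ideal P \<longleftrightarrow> add_subgroup P \<and> (\<forall>x\<in>P. \<forall>r. x * r \<in> P)"

definition graded_right_ideal :: "('g::group_add \<Rightarrow> 'a::ring set) \<Rightarrow> 'a set \<Rightarrow> bool" where
  "graded_right_ideal A P \<longleftrightarrow> right_ideal P \<and> (\<forall>x\<in>P. \<forall>g. component A x g \<in> P)"

definition ideal_prod :: "'a::ring set \<Rightarrow> 'a set \<Rightarrow> 'a set" where
  "ideal_prod X Y =
     {\<Sum>i<n. x i * y i | (n::nat) x y. \<forall>i<n. x i \<in> X \<and> y i \<in> Y}"

definition graded_almost_prime :: "('g::group_add \<Rightarrow> 'a::ring set) \<Rightarrow> 'a set \<Rightarrow> bool" where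
  "graded_almost_prime A P \<longleftrightarrow>
     graded_right_ideal A P \<and> P \<noteq> UNIV \<and>
     (\<forall>X Y. graded_right_ideal A X \<longrightarrow> graded_right_ideal A Y \<longrightarrow>
        ideal_prod X Y \<subseteq> P \<longrightarrow> \<not> ideal_prod X Y \<subseteq> ideal_prod P P \<longrightarrow>
        X \<subseteq> P \<or> Y \<subseteq> P)"

definition graded_ring_hom ::
  "('g \<Rightarrow> 'a::ring set) \<Rightarrow> ('g \<Rightarrow> 'b::ring set) \<Rightarrow> ('a \<Rightarrow> 'b) \<Rightarrow> bool" where
  "graded_ring_hom A B f \<longleftrightarrow>
     (\<forall>x y. f (x + y) = f x + f y) \<and>
     (\<forall>x y. f (x * y) = f x * f y) \<and>
     (\<forall>g. f ` A g \<subseteq> B g)"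

definition ker :: "('a::ring \<Rightarrow> 'b::ring) \<Rightarrow> 'a set" where
  "ker f = {x. f x = 0}"

end

theory Submission
  imports Defs
begin

text \<open>
  Graded right ideals of \<open>T\<close> can be pulled back along \<open>f\<close> and tested against \<open>I\<close>.  Because \<open>f\<close>
  commutes with taking homogeneous components (\<open>component_graded_hom\<close>), both preimages and images of
  graded right ideals are graded right ideals.  Because \<open>Ker f\<close> lies in \<open>I\<close>, membership in \<open>I\<close> can be
  checked after applying \<open>f\<close> (\<open>vimage_image_eq_of_ker_subset\<close>); so \<open>f(I)\<close> is proper, and
  \<open>X Y \<subseteq> f(I)\<close> gives the same inclusion upstairs for the preimages of \<open>X\<close> and \<open>Y\<close>.  Finally \<open>f\<close>
  maps products of right ideals onto products of their images (\<open>image_ideal_prod\<close>), so if the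
  product of the preimages were inside \<open>I\<^sup>2\<close>, then \<open>X Y\<close> would be inside \<open>f(I)\<^sup>2\<close>.  Almost primeness
  of \<open>I\<close> therefore applies to the preimages, and surjectivity brings its conclusion back to \<open>T\<close>.
\<close>

lemma graded_ring_hom_zero:
  assumes "graded_ring_hom A B f"
  shows "f 0 = 0"
proof -
  have "f (0 + 0) = f 0 + f 0"
    using assms unfolding graded_ring_hom_def by blast
  then show ?thesis by simp
qed

lemma graded_ring_hom_uminus:
  assumes "graded_ring_hom A B f"
  shows "f (- x) = - f x"
proof -
  have "f (- x + x) = f (- x) + f x"
    using assms unfolding graded_ring_hom_def by blast
  then show ?thesis
    using graded_ring_hom_zero[OF assms] by (simp add: eq_neg_iff_add_eq_0)
qed

lemma graded_ring_hom_sum: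
  assumes "graded_ring_hom A B f"
  shows "f (\<Sum>i\<in>S. h i) = (\<Sum>i\<in>S. f (h i))"
  using assms graded_ring_hom_zero[OF assms]
  by (induction S rule: infinite_finite_induct) (auto simp: graded_ring_hom_def)

lemma component_eqI:
  assumes "grading A" and "decomposes_as A x c"
  shows "component A x = c"
  using assms unfolding component_def grading_def by (blast intro: the1_equality)

lemma decomposes_as_component:
  assumes "grading A"
  shows "decomposes_as A x (component A x)"
  using assms component_eqI[OF assms] unfolding grading_def by metis

text \<open>
  Applying the homomorphism to a homogeneous decomposition of \<open>x\<close> yields one of \<open>f x\<close>: the support
  can only shrink, and the terms that are lost from the sum are zero.
\<close>

lemma decomposes_as_image:
  assumes hom: "graded_ring_hom A B f" and dec: "decomposes_as A x c"
  shows "decomposes_as B (f x) (\<lambda>g. f (c g))"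
proof -
  have fin: "finite {g. c g \<noteq> 0}" and x: "x = (\<Sum>g\<in>{g. c g \<noteq> 0}. c g)"
    and hg: "\<And>g. c g \<in> A g"
    using dec unfolding decomposes_as_def by auto
  have sub: "{g. f (c g) \<noteq> 0} \<subseteq> {g. c g \<noteq> 0}"
    using graded_ring_hom_zero[OF hom] by auto
  have "f x = (\<Sum>g\<in>{g. c g \<noteq> 0}. f (c g))"
    using graded_ring_hom_sum[OF hom] x by metis
  also have "\<dots> = (\<Sum>g\<in>{g. f (c g) \<noteq> 0}. f (c g))"
    using fin sub by (intro sum.mono_neutral_right) auto
  finally have "f x = (\<Sum>g\<in>{g. f (c g) \<noteq> 0}. f (c g))" .
  moreover have "f (c g) \<in> B g" for g
    using hom hg unfolding graded_ring_hom_def by blast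
  ultimately show ?thesis
    using finite_subset[OF sub fin] unfolding decomposes_as_def by blast
qed

lemma component_graded_hom:
  assumes "grading A" and "grading B" and "graded_ring_hom A B f"
  shows "component B (f x) g = f (component A x g)"
  using component_eqI[OF assms(2) decomposes_as_image[OF assms(3)
        decomposes_as_component[OF assms(1)]]]
  by simp

lemma graded_right_ideal_vimage:
  assumes "grading A" and "grading B" and hom: "graded_ring_hom A B f"
    and X: "graded_right_ideal B X"
  shows "graded_right_ideal A (f -` X)"
  using X hom graded_ring_hom_zero[OF hom] graded_ring_hom_uminus[OF hom]
  unfolding graded_right_ideal_def right_ideal_def add_subgroup_def graded_ring_hom_def
  by (auto simp: component_graded_hom[OF assms(1-3), symmetric])

text \<open>Surjectivity is what makes the image absorb multiplication by every element of the target.\<close>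

lemma graded_right_ideal_image:
  assumes "grading A" and "grading B" and hom: "graded_ring_hom A B f" and "surj f"
    and P: "graded_right_ideal A P"
  shows "graded_right_ideal B (f ` P)"
proof -
  have add: "f x + f y = f (x + y)" and mult: "f x * f y = f (x * y)" for x y
    using hom unfolding graded_ring_hom_def by auto
  have zero: "0 \<in> P" and closed: "\<And>x y. x \<in> P \<Longrightarrow> y \<in> P \<Longrightarrow> x + y \<in> P"
    "\<And>x. x \<in> P \<Longrightarrow> - x \<in> P" "\<And>x r. x \<in> P \<Longrightarrow> x * r \<in> P"
    "\<And>x g. x \<in> P \<Longrightarrow> component A x g \<in> P"
    using P unfolding graded_right_ideal_def right_ideal_def add_subgroup_def by auto
  have "0 \<in> f ` P"
    using zero graded_ring_hom_zero[OF hom] by (metis imageI)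
  moreover have "f x * r \<in> f ` P" if "x \<in> P" for x r
  proof -
    obtain s where "r = f s" using \<open>surj f\<close> by blast
    then show ?thesis using mult closed(3) that by simp
  qed
  ultimately show ?thesis
    unfolding graded_right_ideal_def right_ideal_def add_subgroup_def
    by (auto simp: add component_graded_hom[OF assms(1-3)]
        graded_ring_hom_uminus[OF hom, symmetric] intro: closed)
qed

lemma image_ideal_prod:
  assumes hom: "graded_ring_hom A B f"
  shows "f ` ideal_prod X Y = ideal_prod (f ` X) (f ` Y)"
proof -
  have map: "f (\<Sum>i<n. x i * y i) = (\<Sum>i<n. f (x i) * f (y i))" for n :: nat and x y
    using hom by (simp add: graded_ring_hom_sum[OF hom]) (simp add: graded_ring_hom_def)
  show ?thesis
  proof (intro equalityI subsetI)
    fix z assume "z \<in> f ` ideal_prod X Y"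
    then obtain n :: nat and x y
      where "z = f (\<Sum>i<n. x i * y i)" and "\<forall>i<n. x i \<in> X \<and> y i \<in> Y"
      unfolding ideal_prod_def by blast
    then have "z = (\<Sum>i<n. f (x i) * f (y i))" and "\<forall>i<n. f (x i) \<in> f ` X \<and> f (y i) \<in> f ` Y"
      using map by auto
    then show "z \<in> ideal_prod (f ` X) (f ` Y)"
      unfolding ideal_prod_def
      by (intro CollectI exI[of _ n] exI[of _ "\<lambda>i. f (x i)"] exI[of _ "\<lambda>i. f (y i)"]) simp
  next
    fix z assume "z \<in> ideal_prod (f ` X) (f ` Y)"
    then obtain n :: nat and x y
      where z: "z = (\<Sum>i<n. x i * y i)" and xy: "\<forall>i<n. x i \<in> f ` X \<and> y i \<in> f ` Y"
      unfolding ideal_prod_def by blast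
    have "\<forall>i. \<exists>u v. i < n \<longrightarrow> u \<in> X \<and> v \<in> Y \<and> x i = f u \<and> y i = f v"
      using xy by blast
    then obtain u v where uv: "\<forall>i<n. u i \<in> X \<and> v i \<in> Y \<and> x i = f (u i) \<and> y i = f (v i)"
      by metis
    have "z = f (\<Sum>i<n. u i * v i)"
      using uv by (simp add: z map)
    moreover have "(\<Sum>i<n. u i * v i) \<in> ideal_prod X Y"
      using uv unfolding ideal_prod_def by blast
    ultimately show "z \<in> f ` ideal_prod X Y" by blast
  qed
qed

text \<open>
  If \<open>f x = f p\<close> with \<open>p \<in> P\<close>, then \<open>x\<close> differs from \<open>p\<close> by an element of the kernel, which \<open>P\<close>
  already contains.
\<close>

lemma vimage_image_eq_of_ker_subset:
  assumes hom: "graded_ring_hom A B f" and P: "add_subgroup P" and ker: "ker f \<subseteq> P"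
  shows "f -` f ` P = P"
proof (intro equalityI subsetI)
  fix x assume "x \<in> f -` f ` P"
  then obtain p where p: "p \<in> P" and eq: "f x = f p" by blast
  have "f (x + - p) = f x + f (- p)"
    using hom unfolding graded_ring_hom_def by blast
  then have "x + - p \<in> P"
    using ker eq graded_ring_hom_uminus[OF hom] unfolding ker_def by auto
  then have "(x + - p) + p \<in> P"
    using P p unfolding add_subgroup_def by blast
  then show "x \<in> P" by simp
qed blast

theorem theorem2p12:
  fixes R :: "'g::group_add \<Rightarrow> 'a::ring set"
    and T :: "'g \<Rightarrow> 'b::ring set"
    and f :: "'a \<Rightarrow> 'b"
    and I :: "'a set"
  assumes "grading R"
    and "grading T"
    and "graded_ring_hom R T f"
    and "surj f"
    and "graded_almost_prime R I"
    and "ker f \<subseteq> I"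
  shows "graded_almost_prime T (f ` I)"
proof -
  note hom = assms(3)
  have I: "graded_right_ideal R I" and proper: "I \<noteq> UNIV"
    and prime: "\<And>X Y. graded_right_ideal R X \<Longrightarrow> graded_right_ideal R Y \<Longrightarrow>
      ideal_prod X Y \<subseteq> I \<Longrightarrow> \<not> ideal_prod X Y \<subseteq> ideal_prod I I \<Longrightarrow> X \<subseteq> I \<or> Y \<subseteq> I"
    using assms(5) unfolding graded_almost_prime_def by blast+
  have "add_subgroup I"
    using I unfolding graded_right_ideal_def right_ideal_def by blast
  then have saturated: "f -` f ` I = I"
    using vimage_image_eq_of_ker_subset[OF hom _ assms(6)] by blast
  have onto: "f ` (f -` Z) = Z" for Z
    using \<open>surj f\<close> by (rule surj_image_vimage_eq)
  have "X \<subseteq> f ` I \<or> Y \<subseteq> f ` I"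
    if X: "graded_right_ideal T X" and Y: "graded_right_ideal T Y"
      and sub: "ideal_prod X Y \<subseteq> f ` I"
      and nsub: "\<not> ideal_prod X Y \<subseteq> ideal_prod (f ` I) (f ` I)" for X Y
  proof -
    have img: "f ` ideal_prod (f -` X) (f -` Y) = ideal_prod X Y"
      by (simp only: image_ideal_prod[OF hom] onto)
    have "ideal_prod (f -` X) (f -` Y) \<subseteq> I"
      using sub img saturated by blast
    moreover have "\<not> ideal_prod (f -` X) (f -` Y) \<subseteq> ideal_prod I I"
      using nsub img image_ideal_prod[OF hom, of I I] by blast
    ultimately have "f -` X \<subseteq> I \<or> f -` Y \<subseteq> I"
      using prime graded_right_ideal_vimage[OF assms(1,2) hom] X Y by blast
    then show ?thesis
      by (metis image_mono onto)
  qed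
  moreover have "f ` I \<noteq> UNIV"
    using saturated proper by auto
  ultimately show ?thesis
    using graded_right_ideal_image[OF assms(1,2) hom \<open>surj f\<close> I]
    unfolding graded_almost_prime_def by blast
qed

end
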